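(* Let $\alpha,\beta\in\mathcal{A}$ and $x,y\in\beta N$. If $x\supseteq F_\alpha$ and $y\supseteq F_\beta$, then $x\cdot y\supseteq F_{\alpha+\beta}$, where $\alpha+\beta=\{(b,n_b+n_b'):(b,n_b)\in\alpha,\ (b,n_b')\in\beta\}$, i.e. $\alpha+\beta\in\mathcal{A}$ is the pointwise sum $(\alpha+\beta)(b)=\alpha(b)+\beta(b)$ for $b\in\mathcal{B}$.
   Context: $N=\{1,2,3,\dots\}$; $\beta N$ is the set of ultrafilters on $N$, each $n\in N$ being identified with the principal ultrafilter at $n$; $\overline{A}=\{x\in\beta N: A\in x\}$ for $A\subseteq N$. $P$ is the set of prime numbers. The product on $\beta N$: $A\in x\cdot y$ iff $\{n\in N: A/n\in y\}\in x$, where $A/n=\{m\in N: mn\in A\}$. For $A\subseteq N$, $A^k=\{a^k:a\in A\}$; for an ultrafilter $p$, $p^k=\{B\subseteq N:\{a\in N: a^k\in B\}\in p\}$. For $p\in\overline{P}$, $p\restriction P=\{X\cap P:X\in p\}$. A basic ultrafilter is one of the form $p^k$ with $p\in\overline{P}$, $k\in N$; $\mathcal{B}$ is the set of all basic ultrafilters. $\mathcal{A}$ is the set of all functions $\alpha:\mathcal{B}\to N\cup\{0\}$ with finite support. One writes $\alpha=\{(p_1^{k_1},n_1),\dots,(p_m^{k_m},n_m)\}$, with $p_i^{k_i}$ pairwise distinct, if $\alpha(p_i^{k_i})=n_i$ for all $i$ and $\alpha(b)=0$ for all other $b\in\mathcal{B}$ (some $n_i$ may be $0$). For such $\alpha$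 (with all $p_i\in\overline{P}$), $F_\alpha$ is the family of all sets $$(A_1^{k_1})^{(n_1)}\cdots(A_m^{k_m})^{(n_m)}=\Big\{\prod_{i=1}^m\prod_{j=1}^{n_i}a_{i,j}^{k_i}: a_{i,j}\in A_i\text{ for all }i,j,\text{ and all }a_{i,j}\text{ are distinct}\Big\}$$ such that (i) $A_i\in p_i\restriction P$, and (ii) $A_i=A_j$ if $p_i=p_j$, and $A_i\cap A_j=\emptyset$ otherwise. (Whether $F_\alpha\subseteq x$ holds does not depend on which terms with $n_i=0$ are listed.)
   Formalization: Added hypothesis: the empty set is not in F_{α+β}. Without it the claim fails, e.g. α=β={(2^1,1)}, x=y=2 principal, where {2}^{(2)} is empty; the hypothesis is implied by the conclusion, so only false instances are excluded. *)

theory Defs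
  imports "HOL-Computational_Algebra.Primes"
begin

definition NN :: "nat set" where
  "NN = {1..}"

definition primes :: "nat set" where
  "primes = {q. prime q}"

text \<open>Ultrafilters are represented as families of subsets of \<open>NN\<close>, so that \<open>A \<in> x\<close> and
  \<open>F \<subseteq> x\<close> are meant literally.\<close>

definition betaN :: "nat set set set" where
  "betaN = {x. x \<subseteq> Pow NN \<and> NN \<in> x \<and> {} \<notin> x
    \<and> (\<forall>A B. A \<in> x \<and> B \<in> x \<longrightarrow> A \<inter> B \<in> x)
    \<and> (\<forall>A B. A \<in> x \<and> A \<subseteq> B \<and> B \<subseteq> NN \<longrightarrow> B \<in> x)
    \<and> (\<forall>A. A \<subseteq> NN \<longrightarrow> A \<in> x \<or> NN - A \<in> x)}"

definition cl :: "nat set \<Rightarrow> nat set set set" where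
  "cl A = {x \<in> betaN. A \<in> x}"

definition quot :: "nat set \<Rightarrow> nat \<Rightarrow> nat set" where
  "quot A n = {m \<in> NN. m * n \<in> A}"

definition uprod :: "nat set set \<Rightarrow> nat set set \<Rightarrow> nat set set" (infixl \<open>\<odot>\<close> 70) where
  "x \<odot> y = {A. A \<subseteq> NN \<and> {n \<in> NN. quot A n \<in> y} \<in> x}"

definition upow :: "nat set set \<Rightarrow> nat \<Rightarrow> nat set set" where
  "upow p k = {B. B \<subseteq> NN \<and> {a \<in> NN. a ^ k \<in> B} \<in> p}"

definition restr :: "nat set set \<Rightarrow> nat set set" where
  "restr p = {X \<inter> primes | X. X \<in> p}"

definition basic :: "nat set set set" where
  "basic = {upow p k | p k. p \<in> cl primes \<and> k \<in> NN}"

text \<open>Functions from \<open>basic\<close> to the naturals are represented by total functions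
  that are 0 outside \<open>basic\<close>.\<close>

definition \<A> :: "(nat set set \<Rightarrow> nat) set" where
  "\<A> = {\<alpha>. {b. \<alpha> b \<noteq> 0} \<subseteq> basic \<and> finite {b. \<alpha> b \<noteq> 0}}"

text \<open>The listing \<open>(p\<^sub>1, k\<^sub>1), \<dots>, (p\<^sub>m, k\<^sub>m)\<close> is indexed by the pairs \<open>(p, k)\<close> themselves;
  terms with multiplicity 0 are not listed.  Since \<open>P\<^sup>k\<close> and \<open>P\<^sup>l\<close> are disjoint for
  \<open>k \<noteq> l\<close>, the pair \<open>(p, k)\<close> is determined by the basic ultrafilter \<open>p\<^sup>k\<close>.\<close>

definition pairs :: "(nat set set \<Rightarrow> nat) \<Rightarrow> (nat set set \<times> nat) set" where
  "pairs \<alpha> = {(p, k). p \<in> cl primes \<and> k \<in> NN \<and> \<alpha> (upow p k) \<noteq> 0}"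

text \<open>The set \<open>(A\<^sub>1\<^sup>k\<^sup>1)\<^sup>(\<^sup>n\<^sup>1\<^sup>) \<dots> (A\<^sub>m\<^sup>k\<^sup>m)\<^sup>(\<^sup>n\<^sup>m\<^sup>)\<close>;
  \<open>inj_on\<close> says that all \<open>a\<^sub>i\<^sub>j\<close> are distinct, also across different \<open>i\<close>.\<close>

definition prod_set :: "'i set \<Rightarrow> ('i \<Rightarrow> nat set) \<Rightarrow> ('i \<Rightarrow> nat) \<Rightarrow> ('i \<Rightarrow> nat) \<Rightarrow> nat set" where
  "prod_set I A k n = {(\<Prod>i\<in>I. \<Prod>j=1..n i. a i j ^ k i) | a.
     (\<forall>i\<in>I. \<forall>j\<in>{1..n i}. a i j \<in> A i) \<and> inj_on (\<lambda>(i, j). a i j) (SIGMA i:I. {1..n i})}"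

definition F :: "(nat set set \<Rightarrow> nat) \<Rightarrow> nat set set" where
  "F \<alpha> = {prod_set (pairs \<alpha>) A snd (\<lambda>(p, k). \<alpha> (upow p k)) | A.
     (\<forall>i\<in>pairs \<alpha>. A i \<in> restr (fst i)) \<and>
     (\<forall>i\<in>pairs \<alpha>. \<forall>j\<in>pairs \<alpha>. if fst i = fst j then A i = A j else A i \<inter> A j = {})}"

text \<open>\<open>F \<alpha>\<close> may contain the empty set, and is then contained in no ultrafilter.  This happens
  when a principal \<open>p\<close> (a prime number) has total multiplicity at least 2 in \<open>\<alpha>\<close>: take
  \<open>A\<^sub>i = {p}\<close>, which does not contain distinct elements.  It can happen for a sum even if it
  happens for neither summand: if \<open>\<alpha> = {(2, 1)}\<close> and \<open>x\<close> is principal at 2, then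
  \<open>F \<alpha> \<subseteq> x\<close> but \<open>{} \<in> F (\<alpha> + \<alpha>)\<close>.  So \<open>{} \<notin> F (\<alpha> + \<beta>)\<close> is necessary for
  \<open>F (\<alpha> + \<beta>) \<subseteq> x \<odot> y\<close>.  It holds whenever every \<open>p\<close> that occurs is nonprincipal.\<close>

end

(* The product of a member n of a set in F \<alpha> with a member of a set in F \<beta> can only
   fail to lie in the corresponding set of F (\<alpha> + \<beta>) because some prime is used on both sides.
   So, for each fixed n, the finitely many primes occurring in n are removed from the sets A\<^sub>i
   before passing to F \<beta>.  The reduced sets stay in the ultrafilters unless one of the p\<^sub>i is
   principal at a removed prime q; then p\<^sub>i has multiplicity at least 2 in \<alpha> + \<beta>, and
   replacing A\<^sub>i by {q} shows {} \<in> F (\<alpha> + \<beta>). *)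
theory Submission
  imports Defs
begin

section \<open>Ultrafilters on \<open>NN\<close>\<close>

lemma betaN_Int: "x \<in> betaN \<Longrightarrow> A \<in> x \<Longrightarrow> B \<in> x \<Longrightarrow> A \<inter> B \<in> x"
  unfolding betaN_def by blast

lemma betaN_mono: "x \<in> betaN \<Longrightarrow> A \<in> x \<Longrightarrow> A \<subseteq> B \<Longrightarrow> B \<subseteq> NN \<Longrightarrow> B \<in> x"
  unfolding betaN_def by blast

lemma betaN_empty: "x \<in> betaN \<Longrightarrow> {} \<notin> x"
  unfolding betaN_def by blast

lemma betaN_compl: "x \<in> betaN \<Longrightarrow> A \<subseteq> NN \<Longrightarrow> A \<in> x \<or> NN - A \<in> x"
  unfolding betaN_def by blast

lemma betaN_subset:
  assumes "x \<in> betaN" and "A \<in> x"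
  shows "A \<subseteq> NN"
proof -
  have "x \<subseteq> Pow NN" using assms(1) by (simp add: betaN_def)
  then show ?thesis using assms(2) by blast
qed

text \<open>The points of \<open>S\<close> are removed one at a time. At the first removal that
  loses membership in \<open>x\<close>, the complement of the removed point \<open>s\<close> is not
  in \<open>x\<close>; hence \<open>{s}\<close> is in \<open>x\<close>, and as two members of
  \<open>x\<close> always meet, \<open>s\<close> lies in \<open>U\<close>.\<close>

lemma betaN_diff_finite:
  assumes x: "x \<in> betaN" and U: "U \<in> x" and "finite S" and "U - S \<notin> x"
  shows "\<exists>q\<in>S \<inter> U. {q} \<in> x"
  using assms(3,4)
proof (induction S)
  case empty
  then show ?case using U by simp
next
  case (insert s S)
  show ?case
  proof (cases "U - S \<in> x")
    case False
    then show ?thesis using insert.IH by blast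
  next
    case True
    have "U - insert s S = (U - S) \<inter> (NN - {s})"
      using betaN_subset[OF x U] by blast
    then have "NN - {s} \<notin> x"
      using betaN_Int[OF x True] insert.prems by metis
    moreover have "s \<in> NN"
    proof (rule ccontr)
      assume "s \<notin> NN"
      then have "U - insert s S = U - S" using betaN_subset[OF x U] by blast
      then show False using True insert.prems by simp
    qed
    ultimately have s: "{s} \<in> x" using betaN_compl[OF x, of "{s}"] by blast
    then have "s \<in> U"
      using betaN_Int[OF x U s] betaN_empty[OF x] by (cases "s \<in> U") auto
    then show ?thesis using s by blast
  qed
qed

lemma restr_iff:
  assumes "p \<in> cl primes"
  shows "A \<in> restr p \<longleftrightarrow> A \<in> p \<and> A \<subseteq> primes"
proof -
  have p: "p \<in> betaN" "primes \<in> p" using assms by (auto simp: cl_def)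
  show ?thesis
    unfolding restr_def using betaN_Int[OF p(1) _ p(2)] by (auto simp: Int_absorb2)
qed

section \<open>A basic ultrafilter determines its base and its exponent\<close>

lemma primes_subset_NN: "primes \<subseteq> NN"
  unfolding primes_def NN_def using prime_ge_1_nat by fastforce

lemma prime_power_eq_prime_power:
  fixes a b k l :: nat
  assumes "prime a" "prime b" "0 < k" "0 < l" "a ^ k = b ^ l"
  shows "k = l"
proof -
  have "a dvd a ^ k" using assms(3) by (simp add: dvd_power)
  then have "a dvd b" using prime_dvd_power[OF assms(1)] assms(5) by simp
  then have "a = b" using primes_dvd_imp_eq assms(1,2) by blast
  then show ?thesis using assms(5) prime_gt_1_nat[OF assms(1)] by simp
qed

text \<open>The set of \<open>k\<close>-th powers of primes belongs to \<open>upow p k\<close>. If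
  it also belongs to \<open>upow q l\<close>, then some prime has an \<open>l\<close>-th power that
  is the \<open>k\<close>-th power of a prime, which forces equal exponents.\<close>

lemma upow_exponent:
  assumes "p \<in> cl primes" "q \<in> cl primes" "k \<in> NN" "l \<in> NN" "upow p k = upow q l"
  shows "k = l"
proof -
  let ?B = "(\<lambda>a. a ^ k) ` primes"
  have p: "p \<in> betaN" "primes \<in> p" and q: "q \<in> betaN" "primes \<in> q"
    using assms by (auto simp: cl_def)
  have B: "?B \<subseteq> NN" by (auto simp: primes_def NN_def Suc_le_eq prime_gt_0_nat)
  have "primes \<subseteq> {a \<in> NN. a ^ k \<in> ?B}" using primes_subset_NN by blast
  then have "?B \<in> upow p k"
    unfolding upow_def using B betaN_mono[OF p] by blast
  then have "?B \<in> upow q l" using assms(5) by simp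
  then have "{a \<in> NN. a ^ l \<in> ?B} \<in> q" by (simp add: upow_def)
  then have "{a \<in> NN. a ^ l \<in> ?B} \<inter> primes \<noteq> {}"
    using betaN_Int[OF q(1) _ q(2)] betaN_empty[OF q(1)] by fastforce
  then obtain a b where "a \<in> primes" "b \<in> primes" "a ^ l = b ^ k" by blast
  then have "prime a" "prime b" "a ^ l = b ^ k" by (simp_all add: primes_def)
  moreover have "0 < k" "0 < l" using assms(3,4) by (auto simp: NN_def)
  ultimately show ?thesis using prime_power_eq_prime_power by metis
qed

lemma upow_base_subset:
  assumes "p \<in> betaN" "q \<in> betaN" "k \<in> NN" "upow p k = upow q k"
  shows "p \<subseteq> q"
proof
  fix X assume X: "X \<in> p"
  let ?B = "(\<lambda>a. a ^ k) ` X"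
  have XN: "X \<subseteq> NN" using betaN_subset[OF assms(1) X] .
  then have B: "?B \<subseteq> NN" by (auto simp: NN_def Suc_le_eq)
  \<comment> \<open>For positive \<open>k\<close>, taking \<open>k\<close>-th powers is injective on
    \<open>NN\<close>, so \<open>X\<close> is recovered from its image.\<close>
  have "{a \<in> NN. a ^ k \<in> ?B} = X"
    using XN assms(3) by (auto simp: NN_def power_eq_iff_eq_base)
  then have "?B \<in> upow p k" and "?B \<in> upow q k \<longleftrightarrow> X \<in> q"
    using X B by (auto simp: upow_def)
  then show "X \<in> q" using assms(4) by simp
qed

lemma inj_on_upow: "inj_on (\<lambda>(p, k). upow p k) (cl primes \<times> NN)"
proof (rule inj_onI, clarify)
  fix p k q l
  assume *: "p \<in> cl primes" "k \<in> NN" "q \<in> cl primes" "l \<in> NN" "upow p k = upow q l"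
  then have "k = l" using upow_exponent by blast
  with * show "p = q \<and> k = l"
    using upow_base_subset[of p q k] upow_base_subset[of q p k] by (auto simp: cl_def)
qed

text \<open>Finite support concerns basic ultrafilters, whereas products are indexed by pairs
  \<open>(p, k)\<close>; injectivity of \<open>upow\<close> carries finiteness over.\<close>

lemma finite_pairs:
  assumes "\<alpha> \<in> \<A>"
  shows "finite (pairs \<alpha>)"
proof (rule inj_on_finite)
  show "inj_on (\<lambda>(p, k). upow p k) (pairs \<alpha>)"
    by (rule inj_on_subset[OF inj_on_upow]) (auto simp: pairs_def)
  show "(\<lambda>(p, k). upow p k) ` pairs \<alpha> \<subseteq> {b. \<alpha> b \<noteq> 0}" by (auto simp: pairs_def)
  show "finite {b. \<alpha> b \<noteq> 0}" using assms by (simp add: \<A>_def)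
qed

section \<open>Product sets: change of index set, multiplication, emptiness\<close>

lemma prod_set_mono_neutral:
  assumes "finite K" "I \<subseteq> K" "\<And>i. i \<in> K - I \<Longrightarrow> n i = 0"
  shows "prod_set I A k n = prod_set K A k n"
proof -
  have 1: "(\<Prod>i\<in>I. \<Prod>j=1..n i. a i j ^ k i) = (\<Prod>i\<in>K. \<Prod>j=1..n i. a i j ^ k i)" for a
    by (rule prod.mono_neutral_left) (use assms in auto)
  have 2: "(SIGMA i:I. {1..n i}) = (SIGMA i:K. {1..n i})" using assms(2,3) by fastforce
  have 3: "(\<forall>i\<in>I. \<forall>j\<in>{1..n i}. a i j \<in> A i) \<longleftrightarrow> (\<forall>i\<in>K. \<forall>j\<in>{1..n i}. a i j \<in> A i)" for a
    using assms(2,3) by fastforce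
  show ?thesis unfolding prod_set_def 1 2 3 ..
qed

text \<open>The factors of \<open>m\<close> avoid all values of \<open>a\<close>. Hence, at each
  index, the factors of both numbers can be put in one list, and all factors remain
  distinct.\<close>

lemma prod_set_mult:
  assumes b: "m \<in> prod_set K (\<lambda>i. A i - (\<lambda>(i, j). a i j) ` (SIGMA i:K. {1..n i})) k n'"
    and a: "\<forall>i\<in>K. \<forall>j\<in>{1..n i}. a i j \<in> A i"
      "inj_on (\<lambda>(i, j). a i j) (SIGMA i:K. {1..n i})"
  shows "m * (\<Prod>i\<in>K. \<Prod>j=1..n i. a i j ^ k i) \<in> prod_set K A k (\<lambda>i. n i + n' i)"
proof -
  obtain b where m: "m = (\<Prod>i\<in>K. \<Prod>j=1..n' i. b i j ^ k i)"
    and bA: "\<And>i j. i \<in> K \<Longrightarrow> j \<in> {1..n' i} \<Longrightarrow>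
               b i j \<in> A i - (\<lambda>(i, j). a i j) ` (SIGMA i:K. {1..n i})"
    and binj: "inj_on (\<lambda>(i, j). b i j) (SIGMA i:K. {1..n' i})"
    using b unfolding prod_set_def by blast
  have ba: "b i j \<noteq> a i' j'" if "i \<in> K" "j \<in> {1..n' i}" "i' \<in> K" "j' \<in> {1..n i'}" for i j i' j'
    using bA[OF that(1,2)] that(3,4) by force
  \<comment> \<open>At index \<open>i\<close>, positions up to \<open>n i\<close> are filled from
    \<open>a\<close>, and the next \<open>n' i\<close> from \<open>b\<close>, shifted by
    \<open>n i\<close>.\<close>
  define c where "c i j = (if j \<le> n i then a i j else b i (j - n i))" for i j
  have split: "(\<Prod>j=1..n i + n' i. c i j ^ k i)
      = (\<Prod>j=1..n i. a i j ^ k i) * (\<Prod>j=1..n' i. b i j ^ k i)" for i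
  proof -
    have "(\<Prod>j=1..n i + n' i. c i j ^ k i)
        = (\<Prod>j=1..n i. c i j ^ k i) * (\<Prod>j=n i + 1..n i + n' i. c i j ^ k i)"
      by (rule prod.ub_add_nat) simp
    also have "(\<Prod>j=n i + 1..n i + n' i. c i j ^ k i) = (\<Prod>j=1..n' i. c i (j + n i) ^ k i)"
      using prod.shift_bounds_cl_nat_ivl[of "\<lambda>j. c i j ^ k i" 1 "n i" "n' i"]
      by (simp add: add.commute)
    finally show ?thesis by (simp add: c_def)
  qed
  have "m * (\<Prod>i\<in>K. \<Prod>j=1..n i. a i j ^ k i) = (\<Prod>i\<in>K. \<Prod>j=1..n i + n' i. c i j ^ k i)"
    by (simp only: split prod.distrib m mult.commute)
  moreover have "c i j \<in> A i" if "i \<in> K" "j \<in> {1..n i + n' i}" for i j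
  proof (cases "j \<le> n i")
    case True
    then show ?thesis using a(1) that by (simp add: c_def)
  next
    case False
    then have "j - n i \<in> {1..n' i}" using that(2) by auto
    then show ?thesis using False bA[OF that(1)] by (simp add: c_def)
  qed
  moreover have "inj_on (\<lambda>(i, j). c i j) (SIGMA i:K. {1..n i + n' i})"
  proof (rule inj_onI, clarify)
    fix i j i' j'
    assume *: "i \<in> K" "j \<in> {1..n i + n' i}" "i' \<in> K" "j' \<in> {1..n i' + n' i'}"
      "c i j = c i' j'"
    \<comment> \<open>Each factor comes from \<open>a\<close> or from \<open>b\<close>. The mixed
      cases contradict \<open>ba\<close>; the others use injectivity within one family.\<close>
    consider "j \<le> n i" "j' \<le> n i'" | "j \<le> n i" "n i' < j'" | "n i < j" "j' \<le> n i'"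
      | "n i < j" "n i' < j'" by linarith
    then show "i = i' \<and> j = j'"
    proof cases
      case 1
      then show ?thesis using * inj_onD[OF a(2), of "(i, j)" "(i', j')"] by (simp add: c_def)
    next
      case 2
      then have "j' - n i' \<in> {1..n' i'}" "j \<in> {1..n i}" using *(2,4) by auto
      then show ?thesis using 2 * ba[of i' "j' - n i'" i j] by (simp add: c_def)
    next
      case 3
      then have "j - n i \<in> {1..n' i}" "j' \<in> {1..n i'}" using *(2,4) by auto
      then show ?thesis using 3 * ba[of i "j - n i" i' j'] by (simp add: c_def)
    next
      case 4
      then have "j - n i \<in> {1..n' i}" "j' - n i' \<in> {1..n' i'}" using *(2,4) by auto
      moreover have "b i (j - n i) = b i' (j' - n i')" using 4 *(5) by (simp add: c_def)
      ultimately have "(i, j - n i) = (i', j' - n i')"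
        using *(1,3) by (intro inj_onD[OF binj]) auto
      then show ?thesis using 4 by auto
    qed
  qed
  ultimately have "\<exists>c. m * (\<Prod>i\<in>K. \<Prod>j=1..n i. a i j ^ k i) = (\<Prod>i\<in>K. \<Prod>j=1..n i + n' i. c i j ^ k i)
      \<and> (\<forall>i\<in>K. \<forall>j\<in>{1..n i + n' i}. c i j \<in> A i)
      \<and> inj_on (\<lambda>(i, j). c i j) (SIGMA i:K. {1..n i + n' i})"
    by (intro exI[of _ c]) blast
  then show ?thesis unfolding prod_set_def by simp
qed

text \<open>Two different positions would both have to carry \<open>q\<close>. This is how the empty
  set is exhibited as a member of \<open>F\<close>.\<close>

lemma prod_set_singleton_empty:
  assumes "(i, j) \<in> (SIGMA i:K. {1..n i})" "(i', j') \<in> (SIGMA i:K. {1..n i})"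
    and "(i, j) \<noteq> (i', j')" "A i = {q}" "A i' = {q}"
  shows "prod_set K A k n = {}"
proof -
  have False if "\<forall>i\<in>K. \<forall>j\<in>{1..n i}. a i j \<in> A i"
    "inj_on (\<lambda>(i, j). a i j) (SIGMA i:K. {1..n i})" for a
  proof -
    have "a i j = q" "a i' j' = q" using that(1) assms by auto
    then show False using inj_onD[OF that(2) _ assms(1,2)] assms(3) by simp
  qed
  then show ?thesis unfolding prod_set_def by blast
qed

section \<open>Admissible choices of the sets of primes\<close>

definition admissible :: "(nat set set \<times> nat) set \<Rightarrow> (nat set set \<times> nat \<Rightarrow> nat set) \<Rightarrow> bool" where
  "admissible I A \<longleftrightarrow> (\<forall>i\<in>I. A i \<in> restr (fst i)) \<and>
     (\<forall>i\<in>I. \<forall>j\<in>I. if fst i = fst j then A i = A j else A i \<inter> A j = {})"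

lemma admissibleI:
  assumes "\<And>i. i \<in> I \<Longrightarrow> A i \<in> restr (fst i)"
    and "\<And>i j. i \<in> I \<Longrightarrow> j \<in> I \<Longrightarrow> fst i = fst j \<Longrightarrow> A i = A j"
    and "\<And>i j. i \<in> I \<Longrightarrow> j \<in> I \<Longrightarrow> fst i \<noteq> fst j \<Longrightarrow> A i \<inter> A j = {}"
  shows "admissible I A"
  unfolding admissible_def if_bool_eq_conj using assms by (intro conjI ballI impI)

lemma admissibleD:
  assumes "admissible I A"
  shows "i \<in> I \<Longrightarrow> A i \<in> restr (fst i)"
    and "i \<in> I \<Longrightarrow> j \<in> I \<Longrightarrow> fst i = fst j \<Longrightarrow> A i = A j"
    and "i \<in> I \<Longrightarrow> j \<in> I \<Longrightarrow> fst i \<noteq> fst j \<Longrightarrow> A i \<inter> A j = {}"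
  using assms unfolding admissible_def if_bool_eq_conj by blast+

lemma F_alt:
  "F \<alpha> = {prod_set (pairs \<alpha>) A snd (\<lambda>(p, k). \<alpha> (upow p k)) | A. admissible (pairs \<alpha>) A}"
  unfolding F_def admissible_def ..

text \<open>Extra indices carry multiplicity 0, so members of \<open>F \<alpha>\<close> may be
  formed over a larger index set, in particular over the one belonging to a sum.\<close>

lemma prod_set_in_F:
  assumes "finite K" "pairs \<alpha> \<subseteq> K" "K \<subseteq> cl primes \<times> NN" "admissible K A"
  shows "prod_set K A snd (\<lambda>(p, k). \<alpha> (upow p k)) \<in> F \<alpha>"
proof -
  have "prod_set (pairs \<alpha>) A snd (\<lambda>(p, k). \<alpha> (upow p k))
      = prod_set K A snd (\<lambda>(p, k). \<alpha> (upow p k))"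
    by (rule prod_set_mono_neutral) (use assms in \<open>auto simp: pairs_def\<close>)
  moreover have "admissible (pairs \<alpha>) A"
    using assms(2,4) unfolding admissible_def by (meson subsetD)
  ultimately show ?thesis unfolding F_alt by blast
qed

text \<open>All indices with the same base must carry the same set, so they are all changed
  together. Disjointness survives because \<open>q\<close>, lying in \<open>A l\<close>, is in no
  set with another base.\<close>

lemma admissible_singleton:
  assumes A: "admissible K A" and l: "l \<in> K" "fst l \<in> cl primes" "q \<in> A l" "{q} \<in> fst l"
  shows "admissible K (\<lambda>i. if fst i = fst l then {q} else A i)"
proof -
  have q: "{q} \<in> restr (fst l)"
    using admissibleD(1)[OF A l(1)] l(3,4) restr_iff[OF l(2)] by blast
  have disj: "q \<notin> A i" if "i \<in> K" "fst i \<noteq> fst l" for i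
    using admissibleD(3)[OF A that(1) l(1) that(2)] l(3) by blast
  let ?A = "\<lambda>i. if fst i = fst l then {q} else A i"
  show ?thesis
  proof (rule admissibleI)
    show "?A i \<in> restr (fst i)" if "i \<in> K" for i
      using q admissibleD(1)[OF A that] by simp
    show "?A i = ?A j" if "i \<in> K" "j \<in> K" "fst i = fst j" for i j
      using admissibleD(2)[OF A that] that(3) by simp
    show "?A i \<inter> ?A j = {}" if "i \<in> K" "j \<in> K" "fst i \<noteq> fst j" for i j
      using disj[OF that(1)] disj[OF that(2)] admissibleD(3)[OF A that] that(3) by simp
  qed
qed

text \<open>Upward closure of an ultrafilter and membership in \<open>x \<odot> y\<close> both
  require subsets of \<open>NN\<close>. Here elements are products of powers of primes, hence
  positive.\<close>

lemma F_subset_NN: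
  assumes "D \<in> F \<alpha>"
  shows "D \<subseteq> NN"
proof
  fix d assume d: "d \<in> D"
  obtain A where adm: "admissible (pairs \<alpha>) A"
    and D: "D = prod_set (pairs \<alpha>) A snd (\<lambda>(p, k). \<alpha> (upow p k))"
    using assms unfolding F_alt by blast
  have A: "A i \<subseteq> primes" if i: "i \<in> pairs \<alpha>" for i
  proof -
    have "fst i \<in> cl primes" using i by (auto simp: pairs_def)
    then show ?thesis using admissibleD(1)[OF adm i] restr_iff by blast
  qed
  obtain a where a: "d = (\<Prod>i\<in>pairs \<alpha>. \<Prod>j=1..(case i of (p, k) \<Rightarrow> \<alpha> (upow p k)). a i j ^ snd i)"
    "\<forall>i\<in>pairs \<alpha>. \<forall>j\<in>{1..(case i of (p, k) \<Rightarrow> \<alpha> (upow p k))}. a i j \<in> A i"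
    using d unfolding D prod_set_def by blast
  have "0 < a i j" if "i \<in> pairs \<alpha>" "j \<in> {1..(case i of (p, k) \<Rightarrow> \<alpha> (upow p k))}" for i j
  proof -
    have "a i j \<in> primes" using a(2) A that by blast
    then show ?thesis by (simp add: primes_def prime_gt_0_nat)
  qed
  then have "0 < d" unfolding a(1) by (intro prod_pos) auto
  then show "d \<in> NN" by (simp add: NN_def)
qed

section \<open>The product of two ultrafilters\<close>

theorem theorem5p12:
  fixes \<alpha> \<beta> :: "nat set set \<Rightarrow> nat" and x y :: "nat set set"
  assumes "\<alpha> \<in> \<A>" and "\<beta> \<in> \<A>"
    and "x \<in> betaN" and "y \<in> betaN"
    and "F \<alpha> \<subseteq> x" and "F \<beta> \<subseteq> y"
    and "{} \<notin> F (\<lambda>b. \<alpha> b + \<beta> b)"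
  shows "F (\<lambda>b. \<alpha> b + \<beta> b) \<subseteq> x \<odot> y"
proof
  let ?\<gamma> = "\<lambda>b. \<alpha> b + \<beta> b"
  let ?K = "pairs ?\<gamma>"
  define n n' where "n = (\<lambda>(p, k). \<alpha> (upow p k))" and "n' = (\<lambda>(p, k). \<beta> (upow p k))"
  have "?K = pairs \<alpha> \<union> pairs \<beta>" by (auto simp: pairs_def)
  then have fin: "finite ?K" and sub: "pairs \<alpha> \<subseteq> ?K" "pairs \<beta> \<subseteq> ?K"
    using finite_pairs assms(1,2) by auto
  have cl: "?K \<subseteq> cl primes \<times> NN" by (auto simp: pairs_def)
  have sum: "(\<lambda>(p, k). ?\<gamma> (upow p k)) = (\<lambda>i. n i + n' i)"
    by (auto simp: n_def n'_def)
  fix D assume D: "D \<in> F ?\<gamma>"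
  then obtain A where A: "admissible ?K A"
    and D_eq: "D = prod_set ?K A snd (\<lambda>i. n i + n' i)"
    unfolding F_alt sum by blast
  \<comment> \<open>This suffices: the set over which \<open>d\<close> ranges is in
    \<open>F \<alpha>\<close>, hence in \<open>x\<close>.\<close>
  have "quot D d \<in> y" if d: "d \<in> prod_set ?K A snd n" for d
  proof -
    obtain a where d_eq: "d = (\<Prod>i\<in>?K. \<Prod>j=1..n i. a i j ^ snd i)"
      and a: "\<forall>i\<in>?K. \<forall>j\<in>{1..n i}. a i j \<in> A i"
        "inj_on (\<lambda>(i, j). a i j) (SIGMA i:?K. {1..n i})"
      using d unfolding prod_set_def by blast
    \<comment> \<open>The primes used in the chosen representation of \<open>d\<close>: the bases
      \<open>a i j\<close>, not their powers.\<close>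
    define S where "S = (\<lambda>(i, j). a i j) ` (SIGMA i:?K. {1..n i})"
    have finS: "finite S" unfolding S_def using fin by auto
    have in_restr: "A l - S \<in> restr (fst l)" if l: "l \<in> pairs \<beta>" for l
    proof (rule ccontr)
      assume neg: "A l - S \<notin> restr (fst l)"
      have lK: "l \<in> ?K" and lcl: "fst l \<in> cl primes" and n'l: "1 \<le> n' l"
        using l sub by (auto simp: pairs_def n'_def)
      have Al: "A l \<in> fst l" "A l \<subseteq> primes"
        using admissibleD(1)[OF A lK] restr_iff[OF lcl] by auto
      then have "A l - S \<notin> fst l" using neg restr_iff[OF lcl] by blast
      then obtain q where q: "q \<in> S" "q \<in> A l" "{q} \<in> fst l"
        using betaN_diff_finite[OF _ Al(1) finS] lcl by (auto simp: cl_def)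
      then obtain i j where ij: "i \<in> ?K" "j \<in> {1..n i}" "q = a i j"
        unfolding S_def by auto
      then have "q \<in> A i \<inter> A l" using a(1) q by blast
      \<comment> \<open>Only the bases agree; the exponents of \<open>i\<close> and \<open>l\<close>
        may differ.\<close>
      then have eq: "fst i = fst l" using admissibleD(3)[OF A ij(1) lK] by blast
      let ?A = "\<lambda>i. if fst i = fst l then {q} else A i"
      have "prod_set ?K ?A snd (\<lambda>i. n i + n' i) = {}"
        \<comment> \<open>The second position is the last one at \<open>l\<close>. It differs from
          \<open>(i, j)\<close> even if \<open>i = l\<close>, since then \<open>j \<le> n l\<close>
          while \<open>1 \<le> n' l\<close>.\<close>
        by (rule prod_set_singleton_empty[of i j _ _ l "n l + n' l"])
          (use ij lK n'l eq in auto)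
      moreover have "prod_set ?K ?A snd (\<lambda>i. n i + n' i) \<in> F ?\<gamma>"
        using admissible_singleton[OF A lK lcl q(2,3)] unfolding F_alt sum by blast
      ultimately show False using assms(7) by simp
    qed
    have "admissible (pairs \<beta>) (\<lambda>i. A i - S)"
    proof (rule admissibleI[OF in_restr])
      show "A i - S = A j - S" if "i \<in> pairs \<beta>" "j \<in> pairs \<beta>" "fst i = fst j" for i j
        using admissibleD(2)[OF A _ _ that(3)] that(1,2) sub(2) by blast
      show "(A i - S) \<inter> (A j - S) = {}" if "i \<in> pairs \<beta>" "j \<in> pairs \<beta>" "fst i \<noteq> fst j" for i j
        using admissibleD(3)[OF A _ _ that(3)] that(1,2) sub(2) by blast
    qed
    then have "prod_set (pairs \<beta>) (\<lambda>i. A i - S) snd n' \<in> F \<beta>"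
      unfolding F_alt n'_def by blast
    moreover have "prod_set (pairs \<beta>) (\<lambda>i. A i - S) snd n' = prod_set ?K (\<lambda>i. A i - S) snd n'"
      by (rule prod_set_mono_neutral) (use fin sub cl in \<open>auto simp: pairs_def n'_def\<close>)
    ultimately have inF: "prod_set ?K (\<lambda>i. A i - S) snd n' \<in> F \<beta>" by simp
    \<comment> \<open>Every \<open>m\<close> built from the reduced sets shares no chosen prime with
      \<open>d\<close>, so \<open>m * d\<close> lies in \<open>D\<close>.\<close>
    have "prod_set ?K (\<lambda>i. A i - S) snd n' \<subseteq> quot D d"
      using F_subset_NN[OF inF] prod_set_mult[OF _ a]
      unfolding quot_def D_eq d_eq S_def by blast
    then show ?thesis
      using betaN_mono[OF assms(4)] inF assms(6) by (auto simp: quot_def)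
  qed
  moreover have inF: "prod_set ?K A snd n \<in> F \<alpha>"
    unfolding n_def by (rule prod_set_in_F[OF fin sub(1) cl A])
  ultimately have "prod_set ?K A snd n \<subseteq> {d \<in> NN. quot D d \<in> y}"
    using F_subset_NN[OF inF] by blast
  then have "{d \<in> NN. quot D d \<in> y} \<in> x"
    using betaN_mono[OF assms(3)] inF assms(5) by blast
  then show "D \<in> x \<odot> y"
    using F_subset_NN[OF D] by (simp add: uprod_def)
qed

end
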